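(* Let $X\in\mathbb{M}_1$ have bounded support. Then $X\in\mathbb{M}_1^\star$ if and only if the support of $X$ contains a hole.
   Context: Notation. $\mathbb{M}_1$ is the family of all probability distributions supported in $\mathbb{Z}_+=\{0,1,2,\ldots\}$; $X\in\mathbb{M}_1$ means that the distribution of the random variable $X$ is in $\mathbb{M}_1$ (and similarly for the other classes). For $X\in\mathbb{M}_1$ and $\alpha\in[0,1]$, $\alpha\circ X$ denotes a random variable distributed as $\sum_{i=1}^X B_i$ (empty sum $=0$), where $B_1,B_2,\ldots$ are i.i.d. with $P(B_i=1)=\alpha=1-P(B_i=0)$, independent of $X$. $\mathbb{M}_\alpha$ is the set of all distributions of $\alpha\circ Z$ with $Z\in\mathbb{M}_1$. $\mathbb{M}_1^\star=\mathbb{M}_1\setminus\bigcup_{\gamma\in[0,1)}\mathbb{M}_\gamma$. The support of $X$ is $\{i\in\mathbb{Z}_+:P(X=i)>0\}$; it contains a hole if for some $n\ge1$, $P(X=n)>0=P(X=n-1)$. *)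

theory Defs
  imports "HOL-Probability.Probability"
begin

text \<open>
  A distribution supported in the nonnegative integers is a \<^typ>\<open>nat pmf\<close>, so the family
  \<open>\<M>\<^sub>1\<close> of all such distributions is \<open>UNIV :: nat pmf set\<close>. The support
  \<open>{i. P(X = i) > 0}\<close> is \<^term>\<open>set_pmf p\<close>, where \<open>p\<close> is the law of \<open>X\<close>.
\<close>

text \<open>
  The law of \<open>\<alpha> \<circ> X = B\<^sub>1 + \<dots> + B\<^sub>X\<close>. Given \<open>X = n\<close>, only \<open>B\<^sub>1, \<dots>, B\<^sub>n\<close> matter; by
  independence from \<open>X\<close> their conditional joint law is the product law below, in which the \<open>0\<close>
  is the dummy value taken outside \<open>{1..n}\<close>. Meaningful for \<open>\<alpha> \<in> [0, 1]\<close>.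
\<close>

definition thinning :: "real \<Rightarrow> nat pmf \<Rightarrow> nat pmf" where
  "thinning \<alpha> p =
     bind_pmf p (\<lambda>n. map_pmf (\<lambda>B. \<Sum>i=1..n. B i)
       (Pi_pmf {1..n} 0 (\<lambda>_. map_pmf of_bool (bernoulli_pmf \<alpha>))))"

definition thinned_laws :: "real \<Rightarrow> nat pmf set" where
  "thinned_laws \<alpha> = range (thinning \<alpha>)"

definition unthinned_laws :: "nat pmf set" where
  "unthinned_laws = UNIV - (\<Union>\<gamma>\<in>{0..<1}. thinned_laws \<gamma>)"

definition has_hole :: "nat set \<Rightarrow> bool" where
  "has_hole S \<longleftrightarrow> (\<exists>n\<ge>1. n \<in> S \<and> n - 1 \<notin> S)"

end

theory Submission
  imports Defs "HOL-Computational_Algebra.Polynomial"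
begin

text \<open>
  Given \<open>Z = n\<close>, the variable \<open>\<gamma> \<circ> Z\<close> is binomial with parameters \<open>n\<close> and \<open>\<gamma>\<close>. For
  \<open>0 < \<gamma> < 1\<close> such a law charges every point of \<open>{0..n}\<close>, so the support of \<open>\<gamma> \<circ> Z\<close> is a down-set
  of the nonnegative integers, and for \<open>\<gamma> = 0\<close> it is \<open>{0}\<close>: a thinned law never has a hole
  (lemma \<open>no_hole_thinning\<close>).

  For the converse, let \<open>X\<close> have support \<open>{0..N}\<close>. Its generating function is a polynomial \<open>P\<close>
  of degree \<open>N\<close>, and thinning by \<open>\<gamma>\<close> acts on generating functions as substitution of
  \<open>1 - \<gamma> + \<gamma> s\<close> for \<open>s\<close> (lemma \<open>pmf_thinning_eq_coeff_pcompose\<close>). Substitutions of this kind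
  compose by multiplying their parameters, so the only candidate for \<open>Z\<close> with \<open>X = \<gamma> \<circ> Z\<close> in law
  has generating function \<open>Q(s) = P(1 - \<beta> + \<beta> s)\<close> with \<open>\<beta> = 1 / \<gamma> > 1\<close>. Since \<open>Q(1) = P(1) = 1\<close>,
  the only question is whether \<open>Q\<close> has nonnegative coefficients. These depend continuously on
  \<open>\<beta>\<close>, and for \<open>\<beta> = 1\<close> they are the point masses of \<open>X\<close>, which are positive up to degree \<open>N\<close>
  because there is no hole; hence they remain positive for \<open>\<beta>\<close> slightly above \<open>1\<close>. Boundedness
  of the support makes this a condition on finitely many coefficients.
\<close>

lemma thinning_eq_bind_binomial_pmf:
  assumes "\<alpha> \<in> {0..1}"
  shows "thinning \<alpha> p = bind_pmf p (\<lambda>n. binomial_pmf n \<alpha>)"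
proof -
  have "map_pmf (\<lambda>B. \<Sum>i=1..n. B i)
          (Pi_pmf {1..n} 0 (\<lambda>_. map_pmf of_bool (bernoulli_pmf \<alpha>))) = binomial_pmf n \<alpha>"
    for n :: nat
  proof -
    have "Pi_pmf {1..n} (0::nat) (\<lambda>_. map_pmf of_bool (bernoulli_pmf \<alpha>))
            = map_pmf (\<lambda>h. of_bool \<circ> h) (Pi_pmf {1..n} False (\<lambda>_. bernoulli_pmf \<alpha>))"
      by (rule Pi_pmf_map) auto
    moreover have "(\<Sum>i=1..n. (of_bool \<circ> h) i) = card {i \<in> {1..n}. h i}" for h :: "nat \<Rightarrow> bool"
      by (simp add: Int_def)
    ultimately show ?thesis
      using assms
      by (simp add: map_pmf_comp
          binomial_pmf_altdef'[where A = "{1..n}" and n = n and p = \<alpha> and dflt = False])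
  qed
  then show ?thesis
    by (simp add: thinning_def)
qed

lemma no_hole_thinning:
  assumes "\<gamma> \<in> {0..<1}"
  shows "\<not> has_hole (set_pmf (thinning \<gamma> z))"
proof -
  have "set_pmf (thinning \<gamma> z) = (\<Union>n\<in>set_pmf z. set_pmf (binomial_pmf n \<gamma>))"
    using assms by (simp add: thinning_eq_bind_binomial_pmf)
  moreover have "set_pmf (binomial_pmf n \<gamma>) = (if \<gamma> = 0 then {0} else {..n})" for n
    using assms by (simp add: set_pmf_binomial_eq)
  ultimately show ?thesis
    by (auto simp: has_hole_def split: if_splits dest: order_trans[OF diff_le_self])
qed

lemma set_pmf_eq_atMost_if_no_hole:
  assumes "bdd_above (set_pmf p)" and "\<not> has_hole (set_pmf p)"
  shows "\<exists>N. set_pmf p = {..N}"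
proof -
  have fin: "finite (set_pmf p)"
    using assms(1) by (simp add: bdd_above_nat)
  define N where "N = Max (set_pmf p)"
  \<comment> \<open>Truncated subtraction keeps the claim true, at \<open>0\<close>, once \<open>j\<close> exceeds \<open>N\<close>.\<close>
  have "N - j \<in> set_pmf p" for j
  proof (induction j)
    case 0
    then show ?case
      using fin by (simp add: N_def set_pmf_not_empty)
  next
    case (Suc j)
    then show ?case
      using assms(2) by (cases "N - j = 0") (auto simp: has_hole_def)
  qed
  then have "i \<in> set_pmf p" if "i \<le> N" for i
    using that by (metis diff_diff_cancel)
  moreover have "i \<le> N" if "i \<in> set_pmf p" for i
    using that fin by (simp add: N_def)
  ultimately show ?thesis
    by blast
qed

lemma coeff_pcompose_eq_sum:
  fixes R L :: "'a::comm_semiring_1 poly"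
  shows "coeff (pcompose R L) k = (\<Sum>n\<le>degree R. coeff R n * coeff (L ^ n) k)"
proof -
  have "pcompose R L = (\<Sum>n\<le>degree R. smult (coeff R n) (L ^ n))"
    by (simp add: pcompose_altdef poly_altdef degree_map_poly coeff_map_poly)
  then show ?thesis
    by (simp add: coeff_sum)
qed

lemma coeff_one_minus_power:
  fixes b :: "'a::comm_ring_1"
  shows "coeff ([:1 - b, b:] ^ n) k = of_nat (n choose k) * b ^ k * (1 - b) ^ (n - k)"
proof (cases "k \<le> n")
  case False
  have "degree ([:1 - b, b:] ^ n) \<le> degree [:1 - b, b:] * n"
    by (rule degree_power_le)
  also have "\<dots> \<le> n"
    by simp
  finally show ?thesis
    using False by (simp add: coeff_eq_0 binomial_eq_0)
qed (simp add: coeff_linear_poly_power)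

text \<open>
  Mixing laws is linear in generating functions, and the binomial law with parameters \<open>n\<close> and
  \<open>\<alpha>\<close>, into which thinning turns the point mass at \<open>n\<close>, has generating function
  \<open>(1 - \<alpha> + \<alpha> s)\<^sup>n\<close>. So thinning acts as a substitution on the generating function \<open>R\<close> of \<open>z\<close>,
  which is a polynomial when \<open>z\<close> has finite support.
\<close>

lemma pmf_thinning_eq_coeff_pcompose:
  assumes \<alpha>: "\<alpha> \<in> {0..1}" and R: "coeff R = pmf z"
  shows "pmf (thinning \<alpha> z) k = coeff (pcompose R [:1 - \<alpha>, \<alpha>:]) k"
proof -
  have "n \<le> degree R" if "n \<in> set_pmf z" for n
    using that by (metis R le_degree set_pmf_iff)
  then have "pmf (thinning \<alpha> z) k
      = (\<Sum>n\<le>degree R. pmf (binomial_pmf n \<alpha>) k * pmf z n)"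
    using \<alpha> by (simp add: thinning_eq_bind_binomial_pmf pmf_bind
        integral_measure_pmf_real[where A = "{..degree R}"])
  also have "\<dots> = coeff (pcompose R [:1 - \<alpha>, \<alpha>:]) k"
    using \<alpha> by (simp add: coeff_pcompose_eq_sum coeff_one_minus_power R mult_ac)
  finally show ?thesis .
qed

lemma ex_pmf_eq_coeff:
  fixes Q :: "real poly"
  assumes nonneg: "\<And>k. coeff Q k \<ge> 0" and one: "poly Q 1 = 1"
  shows "\<exists>z. coeff Q = pmf z"
proof -
  have "(\<integral>\<^sup>+k. ennreal (coeff Q k) \<partial>count_space UNIV)
      = (\<Sum>k\<le>degree Q. ennreal (coeff Q k))"
    by (rule nn_integral_count_space') (auto simp: coeff_eq_0 nonneg)
  also have "\<dots> = ennreal (poly Q 1)"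
    by (simp add: poly_altdef nonneg sum_ennreal)
  finally have "pmf (embed_pmf (coeff Q)) k = coeff Q k" for k
    using nonneg one by (intro pmf_embed_pmf) simp_all
  then have "coeff Q = pmf (embed_pmf (coeff Q))"
    by (simp add: fun_eq_iff)
  then show ?thesis
    by blast
qed

lemma ex_poly_coeff_eq_pmf:
  assumes "set_pmf p \<subseteq> {..N}"
  shows "\<exists>P. coeff P = pmf p \<and> degree P \<le> N \<and> poly P 1 = 1"
proof -
  define P where "P = (\<Sum>i\<le>N. monom (pmf p i) i)"
  have "pmf p k = 0" if "\<not> k \<le> N" for k
    using that assms by (auto simp: set_pmf_iff)
  then have "coeff P = pmf p"
    by (auto simp: P_def coeff_sum fun_eq_iff)
  moreover have "degree P \<le> N"
    unfolding P_def
    by (rule degree_sum_le) (auto intro: degree_monom_le[THEN order_trans])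
  moreover have "poly P 1 = 1"
    using assms by (simp add: P_def poly_sum poly_monom sum_pmf_eq_1)
  ultimately show ?thesis
    by blast
qed

text \<open>
  The value of the coefficient at \<open>b = 1\<close> is \<open>coeff P k\<close> because \<open>1 - b + b s\<close> is then the identity.
\<close>

lemma tendsto_coeff_pcompose_one_minus:
  fixes P :: "real poly"
  shows "((\<lambda>b. coeff (pcompose P [:1 - b, b:]) k) \<longlongrightarrow> coeff P k) (at_right 1)"
proof -
  have "continuous (at_right 1) (\<lambda>b. coeff (pcompose P [:1 - b, b:]) k)"
    unfolding coeff_pcompose_eq_sum coeff_one_minus_power
    by (intro continuous_intros)
  then show ?thesis
    by (simp add: continuous_within)
qed

lemma thinned_if_set_pmf_eq_atMost:
  assumes supp: "set_pmf p = {..N}"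
  shows "\<exists>\<gamma>\<in>{0..<1}. p \<in> thinned_laws \<gamma>"
proof -
  obtain P where P: "coeff P = pmf p" and deg: "degree P \<le> N" and P1: "poly P 1 = 1"
    using ex_poly_coeff_eq_pmf[of p N] supp by auto
  define Q where "Q = (\<lambda>b. pcompose P [:1 - b, b:])"
  \<comment> \<open>Only finitely many coefficients must stay positive, so one \<open>b > 1\<close> serves them all.\<close>
  have "\<forall>\<^sub>F b in at_right 1. \<forall>k\<in>{..N}. coeff (Q b) k > 0"
  proof (rule eventually_ball_finite)
    have "\<forall>\<^sub>F b in at_right 1. coeff (Q b) k > 0" if "k \<in> {..N}" for k
    proof (rule order_tendstoD(1))
      show "((\<lambda>b. coeff (Q b) k) \<longlongrightarrow> coeff P k) (at_right 1)"
        unfolding Q_def by (rule tendsto_coeff_pcompose_one_minus)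
      show "coeff P k > 0"
        using that supp P by (simp add: pmf_positive)
    qed
    then show "\<forall>k\<in>{..N}. \<forall>\<^sub>F b in at_right 1. coeff (Q b) k > 0"
      by blast
  qed simp
  moreover have "\<forall>\<^sub>F b in at_right (1::real). b > 1"
    by (rule eventually_at_right_less)
  ultimately have "\<forall>\<^sub>F b in at_right 1. b > 1 \<and> (\<forall>k\<in>{..N}. coeff (Q b) k > 0)"
    by eventually_elim auto
  then obtain \<beta> where \<beta>: "\<beta> > 1" and pos: "\<forall>k\<in>{..N}. coeff (Q \<beta>) k > 0"
    using eventually_happens' trivial_limit_at_right_real by blast
  have "coeff (Q \<beta>) k \<ge> 0" for k
  proof (cases "k \<le> N")
    case True
    then show ?thesis
      using pos by (simp add: less_imp_le)
  next
    case False
    have "degree (Q \<beta>) \<le> N"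
      using deg \<beta> by (simp add: Q_def degree_pcompose)
    then show ?thesis
      using False by (simp add: coeff_eq_0)
  qed
  moreover have "poly (Q \<beta>) 1 = 1"
    using P1 by (simp add: Q_def poly_pcompose)
  ultimately obtain z where z: "coeff (Q \<beta>) = pmf z"
    using ex_pmf_eq_coeff by blast
  define \<gamma> where "\<gamma> = 1 / \<beta>"
  have \<gamma>: "\<gamma> \<in> {0..<1}"
    using \<beta> by (simp add: \<gamma>_def)
  \<comment> \<open>Thinning by \<open>1 / \<beta>\<close> undoes the substitution that produced \<open>Q \<beta>\<close>.\<close>
  have "pcompose [:1 - \<beta>, \<beta>:] [:1 - \<gamma>, \<gamma>:] = [:0, 1:]"
    using \<beta> by (simp add: \<gamma>_def pcompose_pCons field_simps)
  then have "pcompose (Q \<beta>) [:1 - \<gamma>, \<gamma>:] = P"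
    by (simp add: Q_def flip: pcompose_assoc)
  then have "thinning \<gamma> z = p"
    using \<gamma> by (intro pmf_eqI) (simp add: pmf_thinning_eq_coeff_pcompose[OF _ z] P)
  then have "p \<in> thinned_laws \<gamma>"
    by (auto simp: thinned_laws_def)
  then show ?thesis
    using \<gamma> by blast
qed

theorem theorem14:
  fixes p :: "nat pmf"
  assumes "bdd_above (set_pmf p)"
  shows "p \<in> unthinned_laws \<longleftrightarrow> has_hole (set_pmf p)"
proof
  assume "p \<in> unthinned_laws"
  then have "\<not> (\<exists>\<gamma>\<in>{0..<1}. p \<in> thinned_laws \<gamma>)"
    by (auto simp: unthinned_laws_def)
  then show "has_hole (set_pmf p)"
    using set_pmf_eq_atMost_if_no_hole[OF assms] thinned_if_set_pmf_eq_atMost by blast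
next
  assume "has_hole (set_pmf p)"
  then show "p \<in> unthinned_laws"
    using no_hole_thinning by (auto simp: unthinned_laws_def thinned_laws_def)
qed

end
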